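(* Let $d\ge2$ and let $\mathbf{M}=(M_1,\dots,M_n)$ be a POVM on $\mathbb{C}^d$ with $M_i=\alpha_i\ket{\psi_i}\bra{\psi_i}$ (unit vectors $\ket{\psi_i}$), $n\le2d^2$ and $\alpha_i\le\frac1d$. Let $C>0$ be such that $r=Cd$ is a positive integer, and let $\mathcal{S}=\{S_\beta\}_{\beta=1}^r$ be the random partition of $[n]$ obtained by assigning each $i\in[n]$ independently to $S_\beta$ with $\beta$ uniform in $[r]$. Let $\delta\in(0,1]$ satisfy $\delta^3\ge\frac{3C}{2d}(1+\log(4Cd))$. Then with probability at least $1/4$ both of the following hold: (i) $q(\mathbf{M},\mathcal{S})\ge\frac{1}{3.44+2C\log d}$; (ii) $|S_\beta|\le\frac2C(1+\delta)d$ for all $\beta\in[r]$. (Here $\log$ is the natural logarithm.)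
   Context: A POVM on $\mathbb{C}^d$ is a tuple of positive semidefinite operators summing to $\mathbb{I}_d$. For a partition $\mathcal{S}=\{S_\beta\}$ of $[n]$, $q(\mathbf{M},\mathcal{S})=\left(\sum_\beta\left\|\sum_{i\in S_\beta}M_i\right\|\right)^{-1}$, with $\|\cdot\|$ the operator norm (empty sums contribute $0$). *)

theory Defs
  imports "HOL-Analysis.Analysis" "HOL-Probability.Probability"
begin

definition cinner_vec :: "complex ^ 'd \<Rightarrow> complex ^ 'd \<Rightarrow> complex" where
  "cinner_vec u v = (\<Sum>j\<in>UNIV. cnj (u $ j) * v $ j)"

definition hermitian_mat :: "complex ^ 'd ^ 'd \<Rightarrow> bool" where
  "hermitian_mat A \<longleftrightarrow> (\<forall>i j. A $ i $ j = cnj (A $ j $ i))"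

definition psd_mat :: "complex ^ 'd ^ 'd \<Rightarrow> bool" where
  "psd_mat A \<longleftrightarrow> hermitian_mat A \<and> (\<forall>x. 0 \<le> Re (cinner_vec x (A *v x)))"

definition is_povm :: "nat \<Rightarrow> (nat \<Rightarrow> complex ^ 'd ^ 'd) \<Rightarrow> bool" where
  "is_povm n M \<longleftrightarrow> (\<forall>i<n. psd_mat (M i)) \<and> (\<Sum>i<n. M i) = mat 1"

definition op_norm :: "complex ^ 'd ^ 'd \<Rightarrow> real" where
  "op_norm A = onorm (\<lambda>x. A *v x)"

definition rank_one :: "real \<Rightarrow> complex ^ 'd \<Rightarrow> complex ^ 'd ^ 'd" where
  "rank_one a \<psi> = (\<chi> j k. complex_of_real a * \<psi> $ j * cnj (\<psi> $ k))"

definition q_val :: "(nat \<Rightarrow> complex ^ 'd ^ 'd) \<Rightarrow> nat \<Rightarrow> (nat \<Rightarrow> nat set) \<Rightarrow> real" where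
  "q_val M r S = inverse (\<Sum>\<beta><r. op_norm (\<Sum>i\<in>S \<beta>. M i))"

definition block :: "nat \<Rightarrow> (nat \<Rightarrow> nat) \<Rightarrow> nat \<Rightarrow> nat set" where
  "block n f \<beta> = {i. i < n \<and> f i = \<beta>}"

text \<open>Uniformly random assignment of each \<open>i < n\<close> to a block in \<open>{..<r}\<close>
  (equivalently, independent uniform choices).\<close>
definition random_assignment :: "nat \<Rightarrow> nat \<Rightarrow> (nat \<Rightarrow> nat) pmf" where
  "random_assignment n r = pmf_of_set ({..<n} \<rightarrow>\<^sub>E {..<r})"

end

theory Submission
  imports Defs
begin

text \<open>
  Put \<open>v\<^sub>i = \<surd>(d \<alpha>\<^sub>i) \<psi>\<^sub>i\<close>, so that \<open>\<parallel>v\<^sub>i\<parallel> \<le> 1\<close> and \<open>\<Sum>\<^sub>i v\<^sub>i v\<^sub>i\<^sup>* = d I\<close>; let \<open>X\<^sub>S = \<Sum>\<^sub>i\<^sub>\<in>\<^sub>S v\<^sub>i v\<^sub>i\<^sup>*\<close>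
  for a random \<open>S\<close> containing each index independently with probability \<open>p\<close>.
  Moments \<open>\<langle>v, X\<^sup>j v\<rangle>\<close> of a positive operator are log-convex, hence
  \<open>\<langle>v, X\<^sup>i v\<rangle> \<langle>v, X\<^sup>j v\<rangle> \<le> \<parallel>v\<parallel>\<^sup>2 \<langle>v, X\<^sup>i\<^sup>+\<^sup>j v\<rangle>\<close>. Expanding \<open>tr (X + v v\<^sup>*)\<^sup>m\<close> into words, this gives
  \<open>tr exp (X + v v\<^sup>*) - tr exp X \<le> (e - 1) \<langle>v, exp(X) v\<rangle>\<close> for \<open>\<parallel>v\<parallel> \<le> 1\<close>, a rank-one substitute for
  the Golden--Thompson and Lieb inequalities. By the Margulis--Russo formula and tightness of the
  frame, \<open>G(p) = E tr exp X\<^sub>S\<close> satisfies \<open>G' \<le> (e - 1) d G\<close>, so \<open>G(p) \<le> d exp((e - 1) d p)\<close>, and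
  Jensen's inequality yields \<open>E \<parallel>X\<^sub>S\<parallel> \<le> ln d + (e - 1) d p\<close>.
  Summing over the blocks (\<open>p = 1/r\<close>) and using Markov's inequality, (i) fails with probability at
  most \<open>1/2\<close>; by the Chernoff bound and a union bound, (ii) fails with probability at most \<open>1/4\<close>.
  The exponential series is truncated at degree \<open>N\<close> throughout, so that only powers of operators
  occur; the limit \<open>N \<rightarrow> \<infinity>\<close> is taken in the scalar estimate for the operator norm.
\<close>

section \<open>Moments of positive operators\<close>

text \<open>Log-convexity makes the ratios \<open>a (Suc j) / a j\<close> nondecreasing where they
  are defined, so moving two indices apart with fixed sum, out to \<open>0\<close> and
  \<open>i + j\<close>, can only raise the product.\<close>

lemma log_convex_supermult:
  fixes a :: "nat \<Rightarrow> real"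
  assumes nn: "\<And>j. 0 \<le> a j" and lc: "\<And>j. (a (Suc j))\<^sup>2 \<le> a j * a (Suc (Suc j))"
  shows "a i * a j \<le> a 0 * a (i + j)"
proof -
  \<comment> \<open>Monotonicity of the ratios in cross-multiplied form, so that zeros are allowed:
    a vanishing term forces its successor to vanish.\<close>
  have shift: "a (Suc i) * a (i + k) \<le> a i * a (Suc (i + k))" for i k
  proof (induction k)
    case (Suc k)
    show ?case
    proof (cases "a (i + k) = 0")
      case True
      then have "a (Suc (i + k)) = 0" using lc[of "i + k"] by simp
      then show ?thesis using nn by simp
    next
      case False
      then have pos: "0 < a (i + k)" using nn[of "i + k"] by simp
      have "a (i + k) * (a (Suc i) * a (Suc (i + k))) = (a (Suc i) * a (i + k)) * a (Suc (i + k))"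
        by simp
      also have "\<dots> \<le> (a i * a (Suc (i + k))) * a (Suc (i + k))"
        using Suc nn by (intro mult_right_mono) auto
      also have "\<dots> = a i * (a (Suc (i + k)))\<^sup>2" by (simp add: power2_eq_square)
      also have "\<dots> \<le> a i * (a (i + k) * a (Suc (Suc (i + k))))"
        by (intro mult_left_mono lc nn)
      finally have "a (i + k) * (a (Suc i) * a (Suc (i + k)))
          \<le> a (i + k) * (a i * a (Suc (Suc (i + k))))" by (simp add: mult_ac)
      then show ?thesis using pos by simp
    qed
  qed simp
  have le: "a i * a (i + k) \<le> a 0 * a (i + (i + k))" for i k
  proof (induction i arbitrary: k)
    case (Suc i)
    have "a (Suc i) * a (Suc i + k) \<le> a i * a (i + Suc (Suc k))"
      using shift[of i "Suc k"] by simp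
    also have "\<dots> \<le> a 0 * a (i + (i + Suc (Suc k)))" by (rule Suc)
    finally show ?case by simp
  qed simp
  show ?thesis
  proof (cases "i \<le> j")
    case True
    then show ?thesis using le[of i "j - i"] by simp
  next
    case False
    then show ?thesis using le[of j "i - j"] by (simp add: mult.commute add.commute)
  qed
qed

text \<open>On the span of \<open>u\<close> and \<open>w\<close> the form of \<open>X\<close> is a
  nonnegative binary quadratic form, so its discriminant is nonpositive. The form may be degenerate,
  hence the case distinction.\<close>

lemma psd_form_Cauchy_Schwarz:
  fixes X :: "'a::real_inner \<Rightarrow> 'a"
  assumes lin: "linear X" and sym: "\<And>u w. inner (X u) w = inner u (X w)"
    and psd: "\<And>u. 0 \<le> inner u (X u)"
  shows "(inner u (X w))\<^sup>2 \<le> inner u (X u) * inner w (X w)"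
proof -
  define A B D where "A = inner u (X u)" and "B = inner u (X w)" and "D = inner w (X w)"
  have wu: "inner w (X u) = B"
    unfolding B_def by (metis sym inner_commute)
  have q: "0 \<le> s\<^sup>2 * A + 2 * s * t * B + t\<^sup>2 * D" for s t :: real
  proof -
    have "0 \<le> inner (s *\<^sub>R u + t *\<^sub>R w) (X (s *\<^sub>R u + t *\<^sub>R w))" by (rule psd)
    also have "\<dots> = s\<^sup>2 * A + 2 * s * t * B + t\<^sup>2 * D"
      by (simp add: linear_add[OF lin] linear_scale[OF lin] inner_add_left inner_add_right wu
          A_def[symmetric] B_def[symmetric] D_def[symmetric] power2_eq_square algebra_simps)
    finally show ?thesis .
  qed
  have "0 \<le> A" "0 \<le> D" unfolding A_def D_def by (rule psd)+
  consider "D > 0" | "A > 0" | "A = 0" "D = 0" using \<open>0 \<le> A\<close> \<open>0 \<le> D\<close> by linarith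
  then have "B\<^sup>2 \<le> A * D"
  proof cases
    case 1
    \<comment> \<open>Up to scaling, \<open>(D, -B)\<close> minimises the form over \<open>t\<close>
      for fixed \<open>s\<close>.\<close>
    have "0 \<le> D * (A * D - B\<^sup>2)"
      using q[of D "- B"] by (simp add: power2_eq_square algebra_simps)
    then show ?thesis using 1 by (simp add: zero_le_mult_iff)
  next
    case 2
    have "0 \<le> A * (A * D - B\<^sup>2)"
      using q[of "- B" A] by (simp add: power2_eq_square algebra_simps)
    then show ?thesis using 2 by (simp add: zero_le_mult_iff)
  next
    case 3
    then have "B = 0" using q[of 1 1] q[of 1 "-1"] by simp
    then show ?thesis using 3 by simp
  qed
  then show ?thesis unfolding A_def B_def D_def .
qed

lemma funpow_sym:
  fixes X :: "'a::real_inner \<Rightarrow> 'a"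
  assumes "\<And>u w. inner (X u) w = inner u (X w)"
  shows "inner ((X ^^ j) u) w = inner u ((X ^^ j) w)"
  by (induction j arbitrary: u w) (simp_all add: assms funpow_swap1)

text \<open>Split the power symmetrically: even moments are squared norms of
  \<open>(X ^^ s) u\<close>, odd ones are values of the form of \<open>X\<close> there.\<close>

lemma psd_moments_nonneg:
  fixes X :: "'a::real_inner \<Rightarrow> 'a"
  assumes sym: "\<And>u w. inner (X u) w = inner u (X w)"
    and psd: "\<And>u. 0 \<le> inner u (X u)"
  shows "0 \<le> inner u ((X ^^ j) u)"
proof (cases "even j")
  case True
  then obtain s where "j = s + s" by (metis evenE mult_2)
  then have "inner u ((X ^^ j) u) = inner ((X ^^ s) u) ((X ^^ s) u)"
    by (simp add: funpow_add funpow_sym[OF sym])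
  then show ?thesis by simp
next
  case False
  then obtain s where "j = s + Suc s" by (metis oddE mult_2 add_Suc_right Suc_eq_plus1)
  then have "inner u ((X ^^ j) u) = inner ((X ^^ s) u) (X ((X ^^ s) u))"
    by (simp add: funpow_add funpow_sym[OF sym] del: add_Suc_right)
  then show ?thesis using psd by simp
qed

text \<open>Apply Cauchy-Schwarz to the pair \<open>(X ^^ s) u\<close>,
  \<open>(X ^^ Suc s) u\<close>: in the ordinary inner product for even \<open>j\<close>, in the
  semi-inner product defined by \<open>X\<close> for odd \<open>j\<close>. No spectral decomposition
  enters.\<close>

lemma psd_moments_log_convex:
  fixes X :: "'a::real_inner \<Rightarrow> 'a"
  assumes lin: "linear X" and sym: "\<And>u w. inner (X u) w = inner u (X w)"
    and psd: "\<And>u. 0 \<le> inner u (X u)"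
  shows "(inner u ((X ^^ Suc j) u))\<^sup>2 \<le> inner u ((X ^^ j) u) * inner u ((X ^^ Suc (Suc j)) u)"
proof -
  have split: "inner u ((X ^^ (s + t)) u) = inner ((X ^^ s) u) ((X ^^ t) u)" for s t
    by (simp add: funpow_add funpow_sym[OF sym])
  show ?thesis
  proof (cases "even j")
    case True
    then obtain s where j: "j = s + s" by (metis evenE mult_2)
    show ?thesis
      using Cauchy_Schwarz_ineq[of "(X ^^ s) u" "(X ^^ Suc s) u"]
        split[of s s] split[of s "Suc s"] split[of "Suc s" "Suc s"] by (simp add: j)
  next
    case False
    then obtain s where j: "j = s + Suc s" by (metis oddE mult_2 add_Suc_right Suc_eq_plus1)
    show ?thesis
      using psd_form_Cauchy_Schwarz[OF assms, of "(X ^^ s) u" "(X ^^ Suc s) u"]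
        split[of s "Suc s"] split[of s "Suc (Suc s)"] split[of "Suc s" "Suc (Suc s)"]
      by (simp add: j)
  qed
qed

lemma psd_moments_supermult:
  fixes X :: "'a::real_inner \<Rightarrow> 'a"
  assumes "linear X" and "\<And>u w. inner (X u) w = inner u (X w)"
    and "\<And>u. 0 \<le> inner u (X u)"
  shows "inner u ((X ^^ i) u) * inner u ((X ^^ j) u) \<le> inner u u * inner u ((X ^^ (i + j)) u)"
  using log_convex_supermult[of "\<lambda>j. inner u ((X ^^ j) u)" i j]
    psd_moments_nonneg[of X u] psd_moments_log_convex[of X u] assms
  by simp

text \<open>Pascal's rule. For powers \<open>a q = x^q\<close> it is
  \<open>(1+x)^(i+1) = x (1+x)^i + (1+x)^i\<close>, multiplied by \<open>x^l\<close>.\<close>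

lemma binomial_sum_Suc:
  fixes a :: "nat \<Rightarrow> real"
  shows "(\<Sum>q\<le>Suc i. real (Suc i choose q) * a (q + l))
    = (\<Sum>q\<le>i. real (i choose q) * a (q + Suc l)) + (\<Sum>q\<le>i. real (i choose q) * a (q + l))"
proof -
  have "(\<Sum>q\<le>Suc i. real (Suc i choose q) * a (q + l))
      = (\<Sum>q\<le>i. real (i choose q) * a (q + Suc l)) + (a l + (\<Sum>q\<le>i. real (i choose Suc q) * a (Suc q + l)))"
    by (simp add: sum.atMost_Suc_shift algebra_simps sum.distrib del: sum.atMost_Suc)
  also have "a l + (\<Sum>q\<le>i. real (i choose Suc q) * a (Suc q + l)) = (\<Sum>q\<le>Suc i. real (i choose q) * a (q + l))"
    by (simp add: sum.atMost_Suc_shift del: sum.atMost_Suc)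
  finally show ?thesis by (simp add: binomial_eq_0)
qed

text \<open>Here \<open>c i l\<close> stands for the mixed moment of \<open>X^l v\<close> and
  \<open>Y^i v\<close> with \<open>Y = X + v v*\<close>. The lower bound discards the rank-one terms
  of the recursion; the upper bound merges each \<open>a l * a q\<close> into
  \<open>a (q + l)\<close>, which leaves Pascal's recursion.\<close>

lemma update_moments_bounds:
  fixes a :: "nat \<Rightarrow> real" and c :: "nat \<Rightarrow> nat \<Rightarrow> real"
  assumes nn: "\<And>j. 0 \<le> a j" and sup: "\<And>i j. a i * a j \<le> a (i + j)"
    and c0: "\<And>l. c 0 l = a l" and cS: "\<And>i l. c (Suc i) l = c i (Suc l) + a l * c i 0"
  shows "a (i + l) \<le> c i l" and "c i l \<le> (\<Sum>q\<le>i. real (i choose q) * a (q + l))"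
proof -
  have lower: "a (i + l) \<le> c i l" for i l
  proof (induction i arbitrary: l)
    case (Suc i)
    have "0 \<le> c i 0" using Suc[of 0] nn[of i] by simp
    then show ?case using Suc[of "Suc l"] nn[of l] by (simp add: cS add_increasing2)
  qed (simp add: c0)
  show "a (i + l) \<le> c i l" by (rule lower)
  show "c i l \<le> (\<Sum>q\<le>i. real (i choose q) * a (q + l))"
  proof (induction i arbitrary: l)
    case (Suc i)
    have "c (Suc i) l \<le> (\<Sum>q\<le>i. real (i choose q) * a (q + Suc l))
        + a l * (\<Sum>q\<le>i. real (i choose q) * a (q + 0))"
      unfolding cS by (intro add_mono mult_left_mono Suc nn)
    also have "a l * (\<Sum>q\<le>i. real (i choose q) * a (q + 0)) \<le> (\<Sum>q\<le>i. real (i choose q) * a (q + l))"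
      unfolding sum_distrib_left
    proof (rule sum_mono)
      fix q
      show "a l * (real (i choose q) * a (q + 0)) \<le> real (i choose q) * a (q + l)"
        using mult_left_mono[OF sup[of q l], of "real (i choose q)"] by (simp add: mult_ac)
    qed
    also have "(\<Sum>q\<le>i. real (i choose q) * a (q + Suc l)) + (\<Sum>q\<le>i. real (i choose q) * a (q + l))
        = (\<Sum>q\<le>Suc i. real (Suc i choose q) * a (q + l))"
      by (rule binomial_sum_Suc[symmetric])
    finally show ?case by simp
  qed (simp add: c0)
qed

section \<open>Rank-one updates of frame operators\<close>

text \<open>The moment inequalities are stated for real inner product spaces; this identity carries
  them over to complex vectors.\<close>

lemma inner_eq_Re_cinner_vec: "inner u w = Re (cinner_vec u w)"
  by (simp add: inner_vec_def cinner_vec_def inner_complex_def)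

lemma cinner_vec_commute: "cinner_vec u w = cnj (cinner_vec w u)"
  by (simp add: cinner_vec_def mult.commute)

lemma cinner_vec_add_right: "cinner_vec u (w + z) = cinner_vec u w + cinner_vec u z"
  by (simp add: cinner_vec_def distrib_left sum.distrib)

lemma cinner_vec_add_left: "cinner_vec (w + z) u = cinner_vec w u + cinner_vec z u"
  by (simp add: cinner_vec_def distrib_right sum.distrib)

lemma cinner_vec_scale_right: "cinner_vec u (c *s w) = c * cinner_vec u w"
  by (simp add: cinner_vec_def sum_distrib_left mult_ac)

lemma cinner_vec_scale_left: "cinner_vec (c *s w) u = cnj c * cinner_vec w u"
  by (simp add: cinner_vec_def sum_distrib_left mult_ac)

lemma cinner_vec_zero_right [simp]: "cinner_vec u 0 = 0"
  by (simp add: cinner_vec_def)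

lemma cinner_vec_zero_left [simp]: "cinner_vec 0 u = 0"
  by (simp add: cinner_vec_def)

lemma cinner_vec_sum_right: "cinner_vec u (\<Sum>k\<in>S. f k) = (\<Sum>k\<in>S. cinner_vec u (f k))"
  by (induction S rule: infinite_finite_induct) (simp_all add: cinner_vec_add_right)

lemma cinner_vec_sum_left: "cinner_vec (\<Sum>k\<in>S. f k) u = (\<Sum>k\<in>S. cinner_vec (f k) u)"
  by (induction S rule: infinite_finite_induct) (simp_all add: cinner_vec_add_left)

lemma cinner_vec_axis_right: "cinner_vec u (axis j 1) = cnj (u $ j)"
  by (simp add: cinner_vec_def axis_def if_distrib cong: if_cong)

lemma cinner_vec_axis_left: "cinner_vec (axis j 1) u = u $ j"
  by (subst cinner_vec_commute) (simp add: cinner_vec_axis_right)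

lemma norm_cinner_vec_le: "norm (cinner_vec u w) \<le> norm u * norm w"
proof -
  have "norm (cinner_vec u w) \<le> (\<Sum>j\<in>UNIV. norm (cnj (u $ j) * w $ j))"
    unfolding cinner_vec_def by (rule norm_sum)
  also have "\<dots> = (\<Sum>j\<in>UNIV. \<bar>norm (u $ j)\<bar> * \<bar>norm (w $ j)\<bar>)"
    by (simp add: norm_mult)
  also have "\<dots> \<le> norm u * norm w"
    unfolding norm_vec_def by (rule L2_set_mult_ineq)
  finally show ?thesis .
qed

lemma norm_power2_vec: "(norm (u :: complex ^ 'd))\<^sup>2 = (\<Sum>j\<in>UNIV. (norm (u $ j))\<^sup>2)"
  by (simp add: norm_vec_def L2_set_def sum_nonneg)

section \<open>Frame operators, their powers and traces\<close>

text \<open>The operator \<open>X_S\<close>, the sum of \<open>v_k v_k*\<close> over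
  \<open>S\<close>, encoded as a map rather than a matrix so that its powers are \<open>^^\<close>
  and its norm is \<open>onorm\<close>.\<close>

definition frame_op :: "('i \<Rightarrow> complex ^ 'd) \<Rightarrow> 'i set \<Rightarrow> complex ^ 'd \<Rightarrow> complex ^ 'd" where
  "frame_op v S u = (\<Sum>k\<in>S. cinner_vec (v k) u *s v k)"

text \<open>Taking the real part makes the trace a real number from the outset, also for products of
  powers of two different operators.\<close>

definition op_trace :: "(complex ^ 'd \<Rightarrow> complex ^ 'd) \<Rightarrow> real" where
  "op_trace f = (\<Sum>j\<in>UNIV. Re (f (axis j 1) $ j))"

lemma frame_op_insert:
  "finite S \<Longrightarrow> k \<notin> S \<Longrightarrow> frame_op v (insert k S) u = frame_op v S u + cinner_vec (v k) u *s v k"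
  by (simp add: frame_op_def add.commute)

lemma frame_op_add: "frame_op v S (u + w) = frame_op v S u + frame_op v S w"
  by (simp add: frame_op_def cinner_vec_add_right vector_sadd_rdistrib sum.distrib)

lemma frame_op_scale: "frame_op v S (c *s u) = c *s frame_op v S u"
  by (simp add: frame_op_def cinner_vec_scale_right vec.scale_sum_right vector_smult_assoc)

lemma scaleR_eq_smult_vec: "r *\<^sub>R (u :: complex ^ 'd) = complex_of_real r *s u"
  by (simp add: vec_eq_iff complex_eq_iff)

lemma linear_frame_op: "linear (frame_op v S)"
  by (rule linearI) (simp_all add: frame_op_add frame_op_scale scaleR_eq_smult_vec)

lemma frame_op_adjoint: "cinner_vec (frame_op v S u) w = cinner_vec u (frame_op v S w)"
proof -
  have "cinner_vec (frame_op v S u) w = (\<Sum>k\<in>S. cnj (cinner_vec (v k) u) * cinner_vec (v k) w)"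
    by (simp add: frame_op_def cinner_vec_sum_left cinner_vec_scale_left)
  also have "\<dots> = (\<Sum>k\<in>S. cinner_vec (v k) w * cinner_vec u (v k))"
    by (simp add: cinner_vec_commute[of u] mult.commute)
  also have "\<dots> = cinner_vec u (frame_op v S w)"
    by (simp add: frame_op_def cinner_vec_sum_right cinner_vec_scale_right)
  finally show ?thesis .
qed

lemma frame_op_sym: "inner (frame_op v S u) w = inner u (frame_op v S w)"
  by (simp add: inner_eq_Re_cinner_vec frame_op_adjoint)

lemma inner_frame_op: "inner u (frame_op v S u) = (\<Sum>k\<in>S. (norm (cinner_vec (v k) u))\<^sup>2)"
proof -
  have "Re (cinner_vec (v k) u * cinner_vec u (v k)) = (norm (cinner_vec (v k) u))\<^sup>2" for k
    by (subst cinner_vec_commute[of u]) (simp only: complex_norm_square[symmetric] Re_complex_of_real)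
  then show ?thesis
    by (simp only: inner_eq_Re_cinner_vec frame_op_def cinner_vec_sum_right cinner_vec_scale_right Re_sum)
qed

lemma frame_op_psd: "0 \<le> inner u (frame_op v S u)"
  by (simp add: inner_frame_op sum_nonneg)

lemma frame_pow_add: "(frame_op v S ^^ j) (u + w) = (frame_op v S ^^ j) u + (frame_op v S ^^ j) w"
  by (induction j) (simp_all add: frame_op_add)

lemma frame_pow_scale: "(frame_op v S ^^ j) (c *s u) = c *s (frame_op v S ^^ j) u"
  by (induction j) (simp_all add: frame_op_scale)

lemma frame_pow_zero: "(frame_op v S ^^ j) 0 = 0"
  using frame_pow_scale[of j v S 0 0] by simp

lemma frame_pow_sum: "(frame_op v S ^^ j) (\<Sum>k\<in>T. f k) = (\<Sum>k\<in>T. (frame_op v S ^^ j) (f k))"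
  by (induction T rule: infinite_finite_induct) (simp_all add: frame_pow_add frame_pow_zero)

lemma frame_pow_adjoint:
  "cinner_vec ((frame_op v S ^^ j) u) w = cinner_vec u ((frame_op v S ^^ j) w)"
  by (induction j arbitrary: u w) (simp_all add: frame_op_adjoint funpow_swap1)

text \<open>Powers of a Hermitian operator are Hermitian. Realness matters when the real part of a
  product of two such forms has to be the product of the real parts.\<close>

lemma cinner_frame_pow_real:
  "cinner_vec u ((frame_op v S ^^ j) u) = complex_of_real (inner u ((frame_op v S ^^ j) u))"
proof -
  have "cnj (cinner_vec u ((frame_op v S ^^ j) u)) = cinner_vec u ((frame_op v S ^^ j) u)"
    by (simp add: cinner_vec_commute[symmetric] frame_pow_adjoint)
  then show ?thesis by (simp add: inner_eq_Re_cinner_vec complex_eq_iff)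
qed

lemma frame_moments_nonneg: "0 \<le> inner u ((frame_op v S ^^ j) u)"
  by (intro psd_moments_nonneg frame_op_sym frame_op_psd)

lemma frame_moments_supermult:
  "inner u ((frame_op v S ^^ i) u) * inner u ((frame_op v S ^^ j) u)
    \<le> inner u u * inner u ((frame_op v S ^^ (i + j)) u)"
  by (intro psd_moments_supermult linear_frame_op frame_op_sym frame_op_psd)

section \<open>Moments and traces under a rank-one update\<close>

text \<open>Expand the outermost factor \<open>Y = X + v v*\<close> of \<open>Y^(i+1)\<close>: the
  part \<open>X\<close> moves to the left vector by self-adjointness, and \<open>v v*\<close> splits
  the form into a product.\<close>

lemma frame_mixed_moment_Suc:
  assumes "finite S" "k \<notin> S"
  shows "inner ((frame_op v S ^^ l) (v k)) ((frame_op v (insert k S) ^^ Suc i) (v k))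
    = inner ((frame_op v S ^^ Suc l) (v k)) ((frame_op v (insert k S) ^^ i) (v k))
      + inner (v k) ((frame_op v S ^^ l) (v k)) * inner (v k) ((frame_op v (insert k S) ^^ i) (v k))"
    (is "inner (?x l) (?y (Suc i)) = _")
proof -
  have "cinner_vec (?x l) (?y (Suc i)) = cinner_vec (?x (Suc l)) (?y i)
      + cinner_vec (v k) (?y i) * cinner_vec (v k) (?x l)"
    by (simp add: frame_op_insert[OF assms] cinner_vec_add_right cinner_vec_scale_right
        frame_op_adjoint frame_pow_adjoint)
  then show ?thesis
    unfolding cinner_frame_pow_real inner_eq_Re_cinner_vec[of "?x l" "?y (Suc i)"]
      inner_eq_Re_cinner_vec[of "?x (Suc l)" "?y i"]
    by (simp add: mult.commute)
qed

text \<open>Only the factor \<open>Y\<close> adjacent to \<open>X^l\<close> is expanded; the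
  rank-one part contributes the trace of \<open>Y^i v v* X^l\<close>. Iteration passes from the
  trace of \<open>Y^m\<close> to that of \<open>X^m\<close>.\<close>

lemma frame_trace_update_Suc:
  assumes "finite S" "k \<notin> S"
  shows "op_trace (frame_op v (insert k S) ^^ Suc i \<circ> frame_op v S ^^ l)
    = op_trace (frame_op v (insert k S) ^^ i \<circ> frame_op v S ^^ Suc l)
      + inner ((frame_op v S ^^ l) (v k)) ((frame_op v (insert k S) ^^ i) (v k))"
proof -
  let ?X = "frame_op v S" and ?Y = "frame_op v (insert k S)"
  have "(?Y ^^ Suc i) ((?X ^^ l) u) = (?Y ^^ i) ((?X ^^ Suc l) u)
      + cinner_vec ((?X ^^ l) (v k)) u *s (?Y ^^ i) (v k)" for u
    by (simp only: funpow_Suc_right o_apply frame_op_insert[OF assms] frame_pow_add frame_pow_scale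
        frame_pow_adjoint) (simp add: funpow_swap1)
  then have "op_trace (?Y ^^ Suc i \<circ> ?X ^^ l) = op_trace (?Y ^^ i \<circ> ?X ^^ Suc l)
      + (\<Sum>j\<in>UNIV. Re (cnj ((?X ^^ l) (v k) $ j) * (?Y ^^ i) (v k) $ j))"
    by (simp add: op_trace_def sum.distrib cinner_vec_axis_right del: funpow.simps)
  then show ?thesis
    by (simp only: inner_eq_Re_cinner_vec cinner_vec_def Re_sum)
qed

text \<open>Instance of the abstract recursion. The bound on the norm of \<open>v k\<close> removes
  the factor \<open>inner (v k) (v k)\<close> from supermultiplicativity.\<close>

lemma frame_moments_update:
  assumes fin: "finite S" "k \<notin> S" and vk: "norm (v k) \<le> 1"
  defines "a \<equiv> \<lambda>j. inner (v k) ((frame_op v S ^^ j) (v k))"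
  defines "c \<equiv> \<lambda>i l. inner ((frame_op v S ^^ l) (v k)) ((frame_op v (insert k S) ^^ i) (v k))"
  shows "a (i + l) \<le> c i l" and "c i l \<le> (\<Sum>q\<le>i. real (i choose q) * a (q + l))"
proof -
  have nn: "0 \<le> a j" for j unfolding a_def by (rule frame_moments_nonneg)
  have "inner (v k) (v k) \<le> 1"
    using vk by (simp add: dot_square_norm power_le_one)
  then have sup: "a i * a j \<le> a (i + j)" for i j
    using frame_moments_supermult[where u="v k" and v=v and S=S and i=i and j=j] nn[of "i + j"]
    unfolding a_def by (meson mult_left_le_one_le inner_ge_zero order_trans)
  have c0: "c 0 l = a l" for l unfolding a_def c_def by (simp add: inner_commute)
  have cS: "c (Suc i) l = c i (Suc l) + a l * c i 0" for i l
    unfolding a_def c_def using frame_mixed_moment_Suc[where v=v and l=l and i=i, OF fin] by simp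
  show "a (i + l) \<le> c i l" and "c i l \<le> (\<Sum>q\<le>i. real (i choose q) * a (q + l))"
    by (rule update_moments_bounds[of a c, OF nn sup c0 cS])+
qed

text \<open>The increment of the trace is at most the form of \<open>(1 + X)^m - X^m\<close> at
  \<open>v k\<close>, as if \<open>X\<close> and the update were commuting scalars.\<close>

lemma frame_trace_power_update:
  assumes "finite S" "k \<notin> S" "norm (v k) \<le> 1"
  shows "op_trace (frame_op v (insert k S) ^^ m)
    \<le> op_trace (frame_op v S ^^ m)
      + (\<Sum>s<m. real (m choose s) * inner (v k) ((frame_op v S ^^ s) (v k)))"
proof -
  define a where "a j = inner (v k) ((frame_op v S ^^ j) (v k))" for j
  \<comment> \<open>Induction over the hybrid traces of \<open>Y^i X^l\<close>. Subtracting
    \<open>a (i + l)\<close> cancels the summand \<open>q = i\<close>, so the final sum runs over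
    \<open>s < m\<close> only.\<close>
  have "op_trace (frame_op v (insert k S) ^^ i \<circ> frame_op v S ^^ l)
      \<le> op_trace (frame_op v S ^^ (i + l))
        + (\<Sum>q\<le>i. real (i choose q) * a (q + l)) - a (i + l)" for i l
  proof (induction i arbitrary: l)
    case (Suc i)
    show ?case
      using Suc[of "Suc l"]
        frame_moments_update(2)[where v=v and k=k and S=S and i=i and l=l, OF assms, folded a_def]
      unfolding frame_trace_update_Suc[OF assms(1,2)] binomial_sum_Suc add_Suc_right add_Suc
      by linarith
  qed simp
  from this[of m 0] show ?thesis
    by (simp add: a_def lessThan_Suc_atMost[symmetric] id_def comp_def)
qed

section \<open>Operator norm against traces of powers\<close>

text \<open>With \<open>B = X^s\<close>, the form at \<open>x\<close> is a sum of squared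
  coefficients of \<open>B x\<close>, against the standard basis for even \<open>m\<close> and
  against the \<open>v k\<close> for odd \<open>m\<close>. Each is at most a squared norm of
  \<open>B\<close> at that vector, and these norms add up to the trace.\<close>

lemma frame_pow_le_trace:
  assumes "norm x = 1"
  shows "inner x ((frame_op v S ^^ m) x) \<le> op_trace (frame_op v S ^^ m)"
proof -
  define B where "B s = frame_op v S ^^ s" for s
  have adj: "cinner_vec (B s u) w = cinner_vec u (B s w)" for s u w
    unfolding B_def by (rule frame_pow_adjoint)
  have split: "inner u ((frame_op v S ^^ (s + t + s)) u) = inner (B s u) (B t (B s u))" for s t u
    by (simp add: B_def funpow_add inner_eq_Re_cinner_vec frame_pow_adjoint)
  have tr: "op_trace (frame_op v S ^^ m) = (\<Sum>j\<in>UNIV. inner (axis j 1) ((frame_op v S ^^ m) (axis j 1)))"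
    by (simp add: op_trace_def inner_eq_Re_cinner_vec cinner_vec_axis_left)
  have bound: "(norm (cinner_vec u (B s x)))\<^sup>2 \<le> (norm (B s u))\<^sup>2" for u s
    using norm_cinner_vec_le[of "B s u" x] assms by (simp add: adj power_mono)
  show ?thesis
  proof (cases "even m")
    case True
    then obtain s where m: "m = s + 0 + s" by (metis evenE mult_2 add_0_right)
    have "inner x ((frame_op v S ^^ m) x) = (norm (B s x))\<^sup>2"
      unfolding m split by (simp add: B_def dot_square_norm)
    also have "\<dots> = (\<Sum>j\<in>UNIV. (norm (cinner_vec (axis j 1) (B s x)))\<^sup>2)"
      by (simp add: norm_power2_vec cinner_vec_axis_left)
    also have "\<dots> \<le> (\<Sum>j\<in>UNIV. (norm (B s (axis j 1)))\<^sup>2)"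
      by (intro sum_mono bound)
    also have "\<dots> = op_trace (frame_op v S ^^ m)"
      unfolding tr unfolding m split by (simp add: B_def dot_square_norm)
    finally show ?thesis .
  next
    case False
    then obtain s where m: "m = s + 1 + s" by (metis oddE mult_2 add.assoc add.commute)
    have "inner x ((frame_op v S ^^ m) x) = (\<Sum>k\<in>S. (norm (cinner_vec (v k) (B s x)))\<^sup>2)"
      unfolding m split by (simp add: B_def inner_frame_op)
    also have "\<dots> \<le> (\<Sum>k\<in>S. (norm (B s (v k)))\<^sup>2)"
      by (intro sum_mono bound)
    also have "\<dots> = (\<Sum>k\<in>S. \<Sum>j\<in>UNIV. (norm (cinner_vec (v k) (B s (axis j 1))))\<^sup>2)"
      by (simp add: adj[symmetric] norm_power2_vec cinner_vec_axis_right)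
    also have "\<dots> = (\<Sum>j\<in>UNIV. \<Sum>k\<in>S. (norm (cinner_vec (v k) (B s (axis j 1))))\<^sup>2)"
      by (rule sum.swap)
    also have "\<dots> = op_trace (frame_op v S ^^ m)"
      unfolding tr unfolding m split by (simp add: B_def inner_frame_op)
    finally show ?thesis .
  qed
qed

text \<open>Cauchy-Schwarz in the form of \<open>X\<close>, applied to \<open>X u\<close> and
  \<open>u\<close>, bounds the fourth power of the norm of \<open>X u\<close> by two values of the
  form; one factor \<open>(norm (X u))^2\<close> then cancels.\<close>

lemma psd_onorm_le:
  fixes X :: "'a::{real_inner, perfect_space} \<Rightarrow> 'a"
  assumes lin: "linear X" and sym: "\<And>u w. inner (X u) w = inner u (X w)"
    and psd: "\<And>u. 0 \<le> inner u (X u)"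
    and unit: "\<And>u. norm u = 1 \<Longrightarrow> inner u (X u) \<le> b" and b: "0 \<le> b"
  shows "onorm X \<le> b"
proof (rule onorm_le)
  have quad: "inner u (X u) \<le> b * (norm u)\<^sup>2" for u
  proof (cases "u = 0")
    case False
    then have "inner (u /\<^sub>R norm u) (X (u /\<^sub>R norm u)) \<le> b" by (intro unit) simp
    then show ?thesis using False
      by (simp add: linear_scale[OF lin] power2_eq_square field_simps)
  qed (simp add: linear_0[OF lin])
  fix u
  have "((norm (X u))\<^sup>2)\<^sup>2 = (inner (X u) (X u))\<^sup>2" by (simp add: dot_square_norm)
  also have "\<dots> \<le> inner (X u) (X (X u)) * inner u (X u)"
    by (rule psd_form_Cauchy_Schwarz[OF lin sym psd])
  also have "\<dots> \<le> (b * (norm (X u))\<^sup>2) * (b * (norm u)\<^sup>2)"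
    using b by (intro mult_mono quad psd) auto
  finally have "(norm (X u))\<^sup>2 * (norm (X u))\<^sup>2 \<le> (norm (X u))\<^sup>2 * (b * norm u)\<^sup>2"
    by (simp add: power2_eq_square mult_ac)
  then have "(norm (X u))\<^sup>2 \<le> (b * norm u)\<^sup>2 \<or> norm (X u) = 0"
    by (subst (asm) mult_le_cancel_left) auto
  then show "norm (X u) \<le> b * norm u"
    using b by (auto intro: power2_le_imp_le)
qed

text \<open>For unit \<open>u\<close>, supermultiplicativity of moments gives
  \<open>inner u (X u) ^ m \<le> inner u ((X ^^ m) u)\<close>, which is at most the trace. So the
  \<open>m\<close>-th root of the trace bounds the form of \<open>X\<close>, hence its norm.\<close>

lemma frame_onorm_power_le_trace:
  fixes v :: "'i \<Rightarrow> complex ^ 'd"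
  shows "onorm (frame_op v S) ^ m \<le> op_trace (frame_op v S ^^ m)"
proof (cases "m = 0")
  case True
  then show ?thesis by (simp add: op_trace_def axis_def)
next
  case False
  define X where "X = frame_op v S"
  define T where "T = op_trace (X ^^ m)"
  have bl: "bounded_linear X" unfolding X_def by (intro linear_conv_bounded_linear[THEN iffD1] linear_frame_op)
  have pw: "inner u (X u) ^ j \<le> inner u ((X ^^ j) u)" if "norm u = 1" for u j
  proof (induction j)
    case (Suc j)
    have "inner u (X u) ^ Suc j \<le> inner u (X u) * inner u ((X ^^ j) u)"
      using Suc frame_op_psd[of u v S] by (simp add: X_def mult_left_mono)
    also have "\<dots> \<le> inner u ((X ^^ Suc j) u)"
      using frame_moments_supermult[where u=u and v=v and S=S and i=1 and j=j] that by (simp add: X_def dot_square_norm)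
    finally show ?case .
  qed (use that in \<open>simp add: dot_square_norm\<close>)
  have T: "inner u ((X ^^ m) u) \<le> T" if "norm u = 1" for u
    unfolding X_def T_def by (rule frame_pow_le_trace[OF that])
  \<comment> \<open>Any unit vector shows that the trace is nonnegative; \<open>undefined\<close>
    merely picks some coordinate.\<close>
  have "0 \<le> inner (axis undefined 1) ((X ^^ m) (axis undefined (1::complex)))"
    unfolding X_def by (rule frame_moments_nonneg)
  also have "\<dots> \<le> T" by (rule T) simp
  finally have "0 \<le> T" .
  have "onorm X \<le> root m T"
  proof (rule psd_onorm_le)
    show "linear X" unfolding X_def by (rule linear_frame_op)
    show "inner (X u) w = inner u (X w)" for u w unfolding X_def by (rule frame_op_sym)
    show psd: "0 \<le> inner u (X u)" for u unfolding X_def by (rule frame_op_psd)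
    show "0 \<le> root m T" using \<open>0 \<le> T\<close> by (rule real_root_pos_pos_le)
    fix u :: "complex ^ 'd" assume u: "norm u = 1"
    have "inner u (X u) = root m (inner u (X u) ^ m)"
      using False psd by (simp add: real_root_power_cancel)
    also have "\<dots> \<le> root m T"
      using False pw[OF u, of m] T[OF u] by (intro real_root_le_mono) auto
    finally show "inner u (X u) \<le> root m T" .
  qed
  then have "onorm X ^ m \<le> root m T ^ m"
    using onorm_pos_le[OF bl] by (intro power_mono) auto
  also have "\<dots> = T" using False \<open>0 \<le> T\<close> by simp
  finally show ?thesis unfolding X_def T_def .
qed

section \<open>Truncated trace exponentials\<close>

text \<open>Trace of the Taylor polynomial of \<open>exp\<close> of degree \<open>N\<close> at the
  frame operator; \<open>quad_exp\<close> is the quadratic form of the same polynomial at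
  \<open>v k\<close>.\<close>

definition trace_exp :: "('i \<Rightarrow> complex ^ 'd) \<Rightarrow> nat \<Rightarrow> 'i set \<Rightarrow> real" where
  "trace_exp v N S = (\<Sum>m\<le>N. op_trace (frame_op v S ^^ m) / fact m)"

definition quad_exp :: "('i \<Rightarrow> complex ^ 'd) \<Rightarrow> nat \<Rightarrow> 'i \<Rightarrow> 'i set \<Rightarrow> real" where
  "quad_exp v N k S = (\<Sum>m\<le>N. inner (v k) ((frame_op v S ^^ m) (v k)) / fact m)"

lemma sum_inverse_fact_le: "(\<Sum>j=1..N. 1 / fact j) \<le> exp 1 - (1::real)"
proof -
  have "(\<Sum>j\<le>N. 1 / fact j) \<le> (\<Sum>j. 1 / fact j :: real)"
    using summable_exp_generic[of "1::real"] by (intro sum_le_suminf) (auto simp: inverse_eq_divide)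
  also have "\<dots> = exp (1::real)" by (simp add: exp_def inverse_eq_divide)
  finally show ?thesis
    by (simp add: atMost_atLeast0 sum.atLeast_Suc_atMost)
qed

text \<open>Since \<open>(m choose s) / m! = 1 / (s! (m-s)!)\<close>, exchanging the sums leaves an
  inner sum of \<open>1 / j!\<close> over \<open>j = m - s \<ge> 1\<close>. The missing term
  \<open>j = 0\<close> is why the constant is \<open>exp 1 - 1\<close>.\<close>

lemma binomial_exp_sum_le:
  fixes a :: "nat \<Rightarrow> real"
  assumes nn: "\<And>j. 0 \<le> a j"
  shows "(\<Sum>m\<le>N. (\<Sum>s<m. real (m choose s) * a s) / fact m) \<le> (exp 1 - 1) * (\<Sum>s\<le>N. a s / fact s)"
proof -
  have "(\<Sum>m\<le>N. (\<Sum>s<m. real (m choose s) * a s) / fact m)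
      = (\<Sum>m\<le>N. \<Sum>s<m. a s / fact s * (1 / fact (m - s)))"
    by (simp add: sum_divide_distrib binomial_fact)
  also have "\<dots> = (\<Sum>m\<le>N. \<Sum>s\<in>{s \<in> {..N}. s < m}. a s / fact s * (1 / fact (m - s)))"
    by (intro sum.cong) auto
  also have "\<dots> = (\<Sum>s\<le>N. \<Sum>m\<in>{m \<in> {..N}. s < m}. a s / fact s * (1 / fact (m - s)))"
    by (rule sum.swap_restrict) auto
  also have "\<dots> = (\<Sum>s\<le>N. \<Sum>m\<in>{s<..N}. a s / fact s * (1 / fact (m - s)))"
    by (intro sum.cong) auto
  also have "\<dots> \<le> (\<Sum>s\<le>N. a s / fact s * (exp 1 - 1))"
  proof (rule sum_mono)
    fix s assume "s \<in> {..N}"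
    then have "(\<Sum>m\<in>{s<..N}. 1 / fact (m - s)) = (\<Sum>j=1..N-s. 1 / fact j :: real)"
      by (intro sum.reindex_bij_witness[of _ "\<lambda>j. j + s" "\<lambda>m. m - s"]) auto
    then have "(\<Sum>m\<in>{s<..N}. 1 / fact (m - s)) \<le> exp 1 - (1::real)"
      using sum_inverse_fact_le[of "N - s"] by simp
    then show "(\<Sum>m\<in>{s<..N}. a s / fact s * (1 / fact (m - s))) \<le> a s / fact s * (exp 1 - 1)"
      unfolding sum_distrib_left[symmetric] using nn by (intro mult_left_mono) auto
  qed
  finally show ?thesis by (simp add: sum_distrib_left sum_distrib_right mult.commute)
qed

text \<open>The truncation degree is the same on both sides because an update of the
  \<open>m\<close>-th power involves only moments of order \<open>s < m\<close>.\<close>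

lemma trace_exp_insert_le:
  assumes "finite S" "k \<notin> S" "norm (v k) \<le> 1"
  shows "trace_exp v N (insert k S) \<le> trace_exp v N S + (exp 1 - 1) * quad_exp v N k S"
proof -
  have "trace_exp v N (insert k S) \<le> (\<Sum>m\<le>N. (op_trace (frame_op v S ^^ m)
      + (\<Sum>s<m. real (m choose s) * inner (v k) ((frame_op v S ^^ s) (v k)))) / fact m)"
    unfolding trace_exp_def
    by (intro sum_mono divide_right_mono frame_trace_power_update assms) auto
  also have "\<dots> = trace_exp v N S
      + (\<Sum>m\<le>N. (\<Sum>s<m. real (m choose s) * inner (v k) ((frame_op v S ^^ s) (v k))) / fact m)"
    by (simp add: trace_exp_def add_divide_distrib sum.distrib)
  also have "\<dots> \<le> trace_exp v N S + (exp 1 - 1) * quad_exp v N k S"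
    unfolding quad_exp_def by (intro add_left_mono binomial_exp_sum_le frame_moments_nonneg)
  finally show ?thesis .
qed

text \<open>Adding \<open>v k\<close> raises every moment at \<open>v k\<close>. This allows an
  average over sets avoiding \<open>k\<close> to be replaced by one over all sets.\<close>

lemma quad_exp_insert_ge:
  assumes "finite S" "k \<notin> S" "norm (v k) \<le> 1"
  shows "quad_exp v N k S \<le> quad_exp v N k (insert k S)"
  unfolding quad_exp_def
  using frame_moments_update(1)[where v=v and k=k and S=S and l=0, OF assms]
  by (intro sum_mono divide_right_mono) auto

text \<open>For a linear map \<open>B\<close>, summing \<open>inner (v k) (B (v k))\<close> over the
  frame gives the trace of \<open>B\<close> composed with the frame operator of \<open>A\<close>,
  which is \<open>D\<close> times the identity.\<close>

lemma sum_quad_exp: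
  assumes "\<And>u. frame_op v A u = D *\<^sub>R u"
  shows "(\<Sum>k\<in>A. quad_exp v N k S) = D * trace_exp v N S"
proof -
  have "(\<Sum>k\<in>A. inner (v k) ((frame_op v S ^^ m) (v k))) = D * op_trace (frame_op v S ^^ m)" for m
  proof -
    let ?B = "frame_op v S ^^ m"
    have "D * op_trace ?B = (\<Sum>j\<in>UNIV. Re (?B (frame_op v A (axis j 1)) $ j))"
      by (simp add: assms scaleR_eq_smult_vec frame_pow_scale op_trace_def sum_distrib_left)
    also have "\<dots> = (\<Sum>j\<in>UNIV. \<Sum>k\<in>A. Re (cnj (v k $ j) * ?B (v k) $ j))"
      by (simp add: frame_op_def[of v A] frame_pow_sum frame_pow_scale cinner_vec_axis_right)
    also have "\<dots> = (\<Sum>k\<in>A. \<Sum>j\<in>UNIV. Re (cnj (v k $ j) * ?B (v k) $ j))"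
      by (rule sum.swap)
    also have "\<dots> = (\<Sum>k\<in>A. inner (v k) (?B (v k)))"
      by (simp only: inner_eq_Re_cinner_vec cinner_vec_def Re_sum)
    finally show ?thesis by simp
  qed
  then show ?thesis
    unfolding quad_exp_def trace_exp_def
    by (subst sum.swap) (simp add: sum_divide_distrib[symmetric] sum_distrib_left)
qed

lemma trace_exp_empty: "trace_exp (v :: 'i \<Rightarrow> complex ^ 'd) N {} = real CARD('d)"
proof -
  have z: "op_trace (frame_op v {} ^^ m) = (if m = 0 then real CARD('d) else 0)" for m
    by (cases m) (simp_all add: op_trace_def frame_op_def axis_def)
  show ?thesis unfolding trace_exp_def z by (simp add: if_distrib if_distribR cong: if_cong)
qed

lemma truncated_exp_onorm_le: "(\<Sum>m\<le>N. onorm (frame_op v S) ^ m / fact m) \<le> trace_exp v N S"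
  unfolding trace_exp_def by (intro sum_mono divide_right_mono frame_onorm_power_le_trace) auto

section \<open>Expectations over random subsets\<close>

text \<open>Expectation of \<open>F S\<close> when \<open>S\<close> contains each element of
  \<open>A\<close> independently with probability \<open>p\<close>. As an explicit finite sum it is
  a polynomial in \<open>p\<close>, so it can be differentiated at every real
  \<open>p\<close>.\<close>

definition bernoulli_sum :: "'i set \<Rightarrow> real \<Rightarrow> ('i set \<Rightarrow> real) \<Rightarrow> real" where
  "bernoulli_sum A p F = (\<Sum>S\<in>Pow A. p ^ card S * (1 - p) ^ card (A - S) * F S)"

lemma bernoulli_sum_empty [simp]: "bernoulli_sum {} p F = F {}"
  by (simp add: bernoulli_sum_def)

text \<open>Conditioning on whether \<open>k\<close> belongs to the random set.\<close>

lemma bernoulli_sum_insert: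
  assumes "finite A" "k \<notin> A"
  shows "bernoulli_sum (insert k A) p F
    = (1 - p) * bernoulli_sum A p F + p * bernoulli_sum A p (\<lambda>S. F (insert k S))"
proof -
  let ?w = "\<lambda>S. p ^ card S * (1 - p) ^ card (insert k A - S) * F S"
  have "sum ?w (Pow (insert k A)) = sum ?w (Pow A) + sum ?w (insert k ` Pow A)"
    unfolding Pow_insert using assms by (intro sum.union_disjoint) auto
  also have "sum ?w (insert k ` Pow A) = (\<Sum>S\<in>Pow A. ?w (insert k S))"
    using assms by (subst sum.reindex) (auto simp: inj_on_def)
  also have "\<dots> = p * bernoulli_sum A p (\<lambda>S. F (insert k S))"
    unfolding bernoulli_sum_def sum_distrib_left
  proof (rule sum.cong)
    fix S assume S: "S \<in> Pow A"
    then have "card (insert k S) = Suc (card S)" using assms by (auto intro!: card_insert_disjoint intro: finite_subset)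
    moreover have "insert k A - insert k S = A - S" using assms S by auto
    ultimately show "?w (insert k S) = p * (p ^ card S * (1 - p) ^ card (A - S) * F (insert k S))" by simp
  qed simp
  also have "sum ?w (Pow A) = (1 - p) * bernoulli_sum A p F"
    unfolding bernoulli_sum_def sum_distrib_left
  proof (rule sum.cong)
    fix S assume S: "S \<in> Pow A"
    then have "insert k A - S = insert k (A - S)" using assms by auto
    then have "card (insert k A - S) = Suc (card (A - S))" using assms by simp
    then show "?w S = (1 - p) * (p ^ card S * (1 - p) ^ card (A - S) * F S)" by simp
  qed simp
  finally show ?thesis unfolding bernoulli_sum_def .
qed

lemma bernoulli_sum_diff:
  "bernoulli_sum A p (\<lambda>S. F S - G S) = bernoulli_sum A p F - bernoulli_sum A p G"
  by (simp add: bernoulli_sum_def right_diff_distrib sum_subtractf)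

lemma bernoulli_sum_cmult: "bernoulli_sum A p (\<lambda>S. c * F S) = c * bernoulli_sum A p F"
  by (simp add: bernoulli_sum_def sum_distrib_left mult_ac)

lemma bernoulli_sum_sum:
  "bernoulli_sum A p (\<lambda>S. \<Sum>k\<in>K. F k S) = (\<Sum>k\<in>K. bernoulli_sum A p (F k))"
  unfolding bernoulli_sum_def sum_distrib_left by (rule sum.swap)

lemma bernoulli_sum_mono:
  assumes "0 \<le> p" "p \<le> 1" "\<And>S. S \<subseteq> A \<Longrightarrow> F S \<le> G S"
  shows "bernoulli_sum A p F \<le> bernoulli_sum A p G"
  unfolding bernoulli_sum_def using assms by (intro sum_mono mult_left_mono) auto

lemma bernoulli_sum_at_0:
  assumes "finite A"
  shows "bernoulli_sum A 0 F = F {}"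
  using assms by (induction A) (simp_all add: bernoulli_sum_insert)

lemma bernoulli_sum_power_card:
  assumes "finite A"
  shows "bernoulli_sum A p (\<lambda>S. x ^ card S) = (1 - p + p * x) ^ card A"
proof -
  have "bernoulli_sum A p (\<lambda>S. x ^ card S) = (\<Sum>S\<in>Pow A. (\<Prod>k\<in>S. p * x) * (\<Prod>k\<in>A - S. 1 - p))"
    by (simp add: bernoulli_sum_def power_mult_distrib mult_ac)
  also have "\<dots> = (\<Prod>k\<in>A. p * x + (1 - p))"
    by (rule prod_add[OF assms, symmetric])
  finally show ?thesis by (simp add: add.commute)
qed

text \<open>Induction on \<open>A\<close>: condition on the new element \<open>j\<close> and use the
  product rule. Differentiating the weights \<open>p\<close> and \<open>1 - p\<close> yields the
  term for \<open>j\<close>; the remaining terms recombine into those for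
  \<open>k \<in> A\<close>.\<close>

lemma bernoulli_sum_Margulis_Russo:
  assumes "finite A"
  shows "((\<lambda>p. bernoulli_sum A p F) has_real_derivative
    (\<Sum>k\<in>A. bernoulli_sum (A - {k}) p (\<lambda>S. F (insert k S) - F S))) (at p)"
  using assms
proof (induction A arbitrary: F)
  case (insert j A)
  let ?D = "\<lambda>F k. bernoulli_sum (A - {k}) p (\<lambda>S. F (insert k S) - F S)"
  have "((\<lambda>p. (1 - p) * bernoulli_sum A p F + p * bernoulli_sum A p (\<lambda>S. F (insert j S)))
      has_real_derivative
      ((1 - p) * (\<Sum>k\<in>A. ?D F k) - bernoulli_sum A p F
       + (p * (\<Sum>k\<in>A. ?D (\<lambda>S. F (insert j S)) k) + bernoulli_sum A p (\<lambda>S. F (insert j S))))) (at p)"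
    by (rule derivative_eq_intros insert.IH refl)+ simp
  also have "(1 - p) * (\<Sum>k\<in>A. ?D F k) - bernoulli_sum A p F
       + (p * (\<Sum>k\<in>A. ?D (\<lambda>S. F (insert j S)) k) + bernoulli_sum A p (\<lambda>S. F (insert j S)))
     = (\<Sum>k\<in>A. (1 - p) * ?D F k + p * ?D (\<lambda>S. F (insert j S)) k)
       + bernoulli_sum A p (\<lambda>S. F (insert j S) - F S)"
    by (simp add: sum.distrib sum_distrib_left bernoulli_sum_diff)
  also have "(\<Sum>k\<in>A. (1 - p) * ?D F k + p * ?D (\<lambda>S. F (insert j S)) k)
      = (\<Sum>k\<in>A. bernoulli_sum (insert j A - {k}) p (\<lambda>S. F (insert k S) - F S))"
  proof (rule sum.cong)
    fix k assume "k \<in> A"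
    then have "insert j A - {k} = insert j (A - {k})" using insert.hyps by auto
    then show "(1 - p) * ?D F k + p * ?D (\<lambda>S. F (insert j S)) k
        = bernoulli_sum (insert j A - {k}) p (\<lambda>S. F (insert k S) - F S)"
      using insert.hyps by (simp add: bernoulli_sum_insert insert_commute)
  qed simp
  finally show ?case
    using insert.hyps by (simp add: bernoulli_sum_insert add.commute)
qed simp

text \<open>A Gronwall argument in \<open>p\<close>. \<open>step\<close> bounds each increment in
  the derivative, \<open>mono\<close> makes the averages unconditional, and \<open>total\<close>
  closes the differential inequality \<open>G' \<le> g D G\<close>.\<close>

lemma bernoulli_sum_exp_growth:
  fixes F :: "'i set \<Rightarrow> real" and h :: "'i \<Rightarrow> 'i set \<Rightarrow> real"
  assumes fin: "finite A" and p: "0 \<le> p" "p \<le> 1" and g: "0 \<le> g"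
    and step: "\<And>k S. S \<subseteq> A \<Longrightarrow> k \<in> A - S \<Longrightarrow> F (insert k S) \<le> F S + g * h k S"
    and mono: "\<And>k S. S \<subseteq> A \<Longrightarrow> k \<in> A - S \<Longrightarrow> h k S \<le> h k (insert k S)"
    and total: "\<And>S. S \<subseteq> A \<Longrightarrow> (\<Sum>k\<in>A. h k S) \<le> D * F S"
  shows "bernoulli_sum A p F \<le> F {} * exp (g * D * p)"
proof -
  define G where "G q = bernoulli_sum A q F" for q
  define G' where "G' q = (\<Sum>k\<in>A. bernoulli_sum (A - {k}) q (\<lambda>S. F (insert k S) - F S))" for q
  have deriv: "(G has_real_derivative G' q) (at q)" for q
    unfolding G_def[abs_def] G'_def by (rule bernoulli_sum_Margulis_Russo[OF fin])
  have bound: "G' q \<le> g * D * G q" if q: "0 \<le> q" "q \<le> 1" for q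
  proof -
    have "bernoulli_sum (A - {k}) q (\<lambda>S. F (insert k S) - F S) \<le> g * bernoulli_sum A q (h k)"
      if k: "k \<in> A" for k
    proof -
      have "bernoulli_sum (A - {k}) q (\<lambda>S. F (insert k S) - F S)
          \<le> bernoulli_sum (A - {k}) q (\<lambda>S. g * h k S)"
        using q k step by (intro bernoulli_sum_mono) (auto simp: algebra_simps)
      \<comment> \<open>Splitting the average with weights \<open>1 - q\<close> and \<open>q\<close>
        allows \<open>k\<close> to be inserted in the second part, which rebuilds the average over
        subsets of all of \<open>A\<close>.\<close>
      also have "\<dots> = g * ((1 - q) * bernoulli_sum (A - {k}) q (h k) + q * bernoulli_sum (A - {k}) q (h k))"
        by (simp add: bernoulli_sum_cmult algebra_simps)
      also have "\<dots> \<le> g * ((1 - q) * bernoulli_sum (A - {k}) q (h k)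
          + q * bernoulli_sum (A - {k}) q (\<lambda>S. h k (insert k S)))"
        using q k g mono by (intro mult_left_mono add_left_mono bernoulli_sum_mono) auto
      also have "\<dots> = g * bernoulli_sum (insert k (A - {k})) q (h k)"
        using fin by (subst bernoulli_sum_insert) auto
      also have "insert k (A - {k}) = A" using k by auto
      finally show ?thesis .
    qed
    then have "G' q \<le> (\<Sum>k\<in>A. g * bernoulli_sum A q (h k))"
      unfolding G'_def by (rule sum_mono)
    also have "\<dots> = g * bernoulli_sum A q (\<lambda>S. \<Sum>k\<in>A. h k S)"
      by (simp add: bernoulli_sum_sum sum_distrib_left)
    also have "\<dots> \<le> g * bernoulli_sum A q (\<lambda>S. D * F S)"
      using q g total by (intro mult_left_mono bernoulli_sum_mono) auto
    finally show ?thesis by (simp add: bernoulli_sum_cmult G_def)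
  qed
  \<comment> \<open>Integrating factor: \<open>G q * exp (- (g * D * q))\<close> is nonincreasing on
    the interval from \<open>0\<close> to \<open>p\<close>.\<close>
  have "G p * exp (- (g * D * p)) \<le> G 0 * exp (- (g * D * 0))"
  proof (rule DERIV_nonpos_imp_nonincreasing[OF p(1)])
    fix q assume q: "0 \<le> q" "q \<le> p"
    have "((\<lambda>q. G q * exp (- (g * D * q))) has_real_derivative
        (G' q - g * D * G q) * exp (- (g * D * q))) (at q)"
      by (auto intro!: derivative_eq_intros deriv simp: algebra_simps)
    moreover have "(G' q - g * D * G q) * exp (- (g * D * q)) \<le> 0"
      using bound[of q] q p by (simp add: mult_le_0_iff)
    ultimately show "\<exists>y. ((\<lambda>q. G q * exp (- (g * D * q))) has_real_derivative y) (at q) \<and> y \<le> 0"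
      by blast
  qed
  then show ?thesis
    using fin by (simp add: G_def bernoulli_sum_at_0 exp_minus field_simps)
qed

text \<open>The bound for degree \<open>N\<close> does not depend on \<open>N\<close>, since at the
  empty set only the zeroth power contributes to the trace. The left side is a finite sum, so the
  limit passes through it.\<close>

lemma bernoulli_sum_exp_onorm_le:
  fixes v :: "'i \<Rightarrow> complex ^ 'd"
  assumes fin: "finite A" and p: "0 \<le> p" "p \<le> 1"
    and v: "\<And>k. k \<in> A \<Longrightarrow> norm (v k) \<le> 1" and tight: "\<And>u. frame_op v A u = D *\<^sub>R u"
  shows "bernoulli_sum A p (\<lambda>S. exp (onorm (frame_op v S))) \<le> real CARD('d) * exp ((exp 1 - 1) * D * p)"
proof (rule LIMSEQ_le_const2)
  show "(\<lambda>N. bernoulli_sum A p (\<lambda>S. \<Sum>m\<le>N. onorm (frame_op v S) ^ m / fact m))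
      \<longlonglongrightarrow> bernoulli_sum A p (\<lambda>S. exp (onorm (frame_op v S)))"
    unfolding bernoulli_sum_def
  proof (intro tendsto_sum tendsto_mult tendsto_const)
    fix S
    show "(\<lambda>N. \<Sum>m\<le>N. onorm (frame_op v S) ^ m / fact m) \<longlonglongrightarrow> exp (onorm (frame_op v S))"
      using exp_converges[of "onorm (frame_op v S)"]
      by (simp add: sums_def_le divide_inverse mult.commute)
  qed
  have "bernoulli_sum A p (\<lambda>S. \<Sum>m\<le>N. onorm (frame_op v S) ^ m / fact m)
      \<le> real CARD('d) * exp ((exp 1 - 1) * D * p)" for N
  proof -
    have "bernoulli_sum A p (\<lambda>S. \<Sum>m\<le>N. onorm (frame_op v S) ^ m / fact m)
        \<le> bernoulli_sum A p (trace_exp v N)"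
      using p by (intro bernoulli_sum_mono truncated_exp_onorm_le)
    also have "\<dots> \<le> trace_exp v N {} * exp ((exp 1 - 1) * D * p)"
    proof (rule bernoulli_sum_exp_growth[OF fin p])
      fix k S assume "S \<subseteq> A" "k \<in> A - S"
      then have *: "finite S" "k \<notin> S" "norm (v k) \<le> 1" using fin v by (auto intro: finite_subset)
      show "trace_exp v N (insert k S) \<le> trace_exp v N S + (exp 1 - 1) * quad_exp v N k S"
        by (rule trace_exp_insert_le) (use * in auto)
      show "quad_exp v N k S \<le> quad_exp v N k (insert k S)"
        by (rule quad_exp_insert_ge) (use * in auto)
    qed (simp_all add: sum_quad_exp[OF tight])
    finally show ?thesis by (simp add: trace_exp_empty)
  qed
  then show "\<exists>N0. \<forall>N\<ge>N0. bernoulli_sum A p (\<lambda>S. \<Sum>m\<le>N. onorm (frame_op v S) ^ m / fact m)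
      \<le> real CARD('d) * exp ((exp 1 - 1) * D * p)" by blast
qed

section \<open>Random assignments\<close>

lemma set_pmf_random_assignment:
  "r \<ge> 1 \<Longrightarrow> set_pmf (random_assignment n r) = {..<n} \<rightarrow>\<^sub>E {..<r}"
  unfolding random_assignment_def
  by (intro set_pmf_of_set finite_PiE) (auto simp: PiE_eq_empty_iff lessThan_empty_iff)

lemma integrable_random_assignment:
  fixes Z :: "(nat \<Rightarrow> nat) \<Rightarrow> real"
  assumes "r \<ge> 1"
  shows "integrable (measure_pmf (random_assignment n r)) Z"
  using assms by (intro integrable_measure_pmf_finite) (simp add: set_pmf_random_assignment finite_PiE)

lemma block_subset: "block n f \<beta> \<subseteq> {..<n}"
  by (auto simp: block_def)

text \<open>The value is forced to be \<open>\<beta>\<close> on \<open>S\<close> and ranges over the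
  other \<open>r - 1\<close> labels off \<open>S\<close>.\<close>

lemma card_assignments_with_block:
  assumes "S \<subseteq> {..<n}" "\<beta> < r"
  shows "card {f \<in> {..<n} \<rightarrow>\<^sub>E {..<r}. block n f \<beta> = S} = (r - 1) ^ card ({..<n} - S)"
proof -
  have "{f \<in> {..<n} \<rightarrow>\<^sub>E {..<r}. block n f \<beta> = S}
      = (\<Pi>\<^sub>E i\<in>{..<n}. if i \<in> S then {\<beta>} else {..<r} - {\<beta>})" (is "?L = ?R")
  proof (intro equalityI subsetI)
    fix f assume "f \<in> ?L"
    then show "f \<in> ?R" by (auto simp: PiE_iff block_def)
  next
    fix f assume f: "f \<in> ?R"
    then have "f i \<in> (if i \<in> S then {\<beta>} else {..<r} - {\<beta>})" if "i < n" for i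
      using that by (auto simp: PiE_iff)
    then have "f i < r" and "f i = \<beta> \<longleftrightarrow> i \<in> S" if "i < n" for i
      using that assms(2) by (fastforce split: if_splits)+
    then show "f \<in> ?L" using f assms(1) by (auto simp: PiE_iff block_def)
  qed
  then have "card {f \<in> {..<n} \<rightarrow>\<^sub>E {..<r}. block n f \<beta> = S}
      = (\<Prod>i<n. if i \<in> S then 1 else r - 1)"
    using assms(2) by (simp add: card_PiE if_distrib cong: if_cong)
  also have "\<dots> = (r - 1) ^ card ({..<n} - S)"
    by (simp add: prod.If_cases Diff_eq)
  finally show ?thesis .
qed

text \<open>A single block of the uniform assignment is a Bernoulli random subset with
  \<open>p = 1 / r\<close>; the proof groups the assignments by the value of that block.\<close>

lemma expectation_block:
  fixes \<phi> :: "nat set \<Rightarrow> real"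
  assumes "\<beta> < r"
  shows "measure_pmf.expectation (random_assignment n r) (\<lambda>f. \<phi> (block n f \<beta>))
    = bernoulli_sum {..<n} (1 / real r) \<phi>"
proof -
  let ?P = "{..<n} \<rightarrow>\<^sub>E {..<r}"
  have fin: "finite ?P" by (simp add: finite_PiE)
  have ne: "?P \<noteq> {}" using assms by (auto simp: PiE_eq_empty_iff)
  have cardP: "card ?P = r ^ n" by (simp add: card_PiE)
  have "(\<Sum>f\<in>?P. \<phi> (block n f \<beta>)) = (\<Sum>S\<in>Pow {..<n}. \<Sum>f\<in>{f \<in> ?P. block n f \<beta> = S}. \<phi> (block n f \<beta>))"
    using fin block_subset by (intro sum.group[symmetric]) auto
  also have "\<dots> = (\<Sum>S\<in>Pow {..<n}. real ((r - 1) ^ card ({..<n} - S)) * \<phi> S)"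
  proof (rule sum.cong)
    fix S assume "S \<in> Pow {..<n}"
    then have "card {f \<in> ?P. block n f \<beta> = S} = (r - 1) ^ card ({..<n} - S)"
      using assms by (intro card_assignments_with_block) auto
    then show "(\<Sum>f\<in>{f \<in> ?P. block n f \<beta> = S}. \<phi> (block n f \<beta>)) = real ((r - 1) ^ card ({..<n} - S)) * \<phi> S"
      by simp
  qed simp
  finally have "measure_pmf.expectation (random_assignment n r) (\<lambda>f. \<phi> (block n f \<beta>))
      = (\<Sum>S\<in>Pow {..<n}. real ((r - 1) ^ card ({..<n} - S)) * \<phi> S / real r ^ n)"
    unfolding random_assignment_def using fin ne
    by (simp add: integral_pmf_of_set cardP sum_divide_distrib)
  also have "\<dots> = bernoulli_sum {..<n} (1 / real r) \<phi>"
    unfolding bernoulli_sum_def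
  proof (rule sum.cong)
    fix S assume "S \<in> Pow {..<n}"
    then have S: "S \<subseteq> {..<n}" by simp
    then have "card S + card ({..<n} - S) = n"
      using card_mono[OF _ S] by (simp add: card_Diff_subset finite_subset)
    then have "real r ^ n = real r ^ card S * real r ^ card ({..<n} - S)"
      by (metis power_add)
    moreover have "1 - 1 / real r = real (r - 1) / real r"
      using assms by (simp add: field_simps of_nat_diff)
    ultimately show "real ((r - 1) ^ card ({..<n} - S)) * \<phi> S / real r ^ n
        = (1 / real r) ^ card S * (1 - 1 / real r) ^ card ({..<n} - S) * \<phi> S"
      by (simp add: power_divide)
  qed simp
  finally show ?thesis .
qed

lemma random_assignment_Markov:
  fixes Z :: "(nat \<Rightarrow> nat) \<Rightarrow> real"
  assumes "r \<ge> 1" "\<And>f. 0 \<le> Z f" "0 < c"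
  shows "measure_pmf.prob (random_assignment n r) {f. c \<le> Z f}
    \<le> measure_pmf.expectation (random_assignment n r) Z / c"
  using integral_Markov_inequality_measure[of "measure_pmf (random_assignment n r)" Z UNIV c]
    integrable_random_assignment[OF assms(1)] assms by simp

section \<open>Chernoff bound for the block sizes\<close>

text \<open>The difference vanishes at \<open>0\<close> and has derivative
  \<open>y^2 / ((1 + y) (2 + y)^2)\<close>.\<close>

lemma ln_one_plus_ge:
  fixes x :: real
  assumes "0 \<le> x"
  shows "2 * x / (2 + x) \<le> ln (1 + x)"
proof -
  let ?f = "\<lambda>x::real. ln (1 + x) - 2 * x / (2 + x)"
  have "?f 0 \<le> ?f x"
  proof (rule DERIV_nonneg_imp_nondecreasing[OF assms])
    fix y :: real assume y: "0 \<le> y" "y \<le> x"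
    have "(?f has_real_derivative 1 / (1 + y) - (2 * (2 + y) - 2 * y) / (2 + y)\<^sup>2) (at y)"
      using y by (auto intro!: derivative_eq_intros simp: power2_eq_square)
    moreover have "1 / (1 + y) - (2 * (2 + y) - 2 * y) / (2 + y)\<^sup>2 = y\<^sup>2 / ((1 + y) * (2 + y)\<^sup>2)"
      using y by (simp add: divide_simps) (simp add: power2_eq_square algebra_simps)
    moreover have "y\<^sup>2 / ((1 + y) * (2 + y)\<^sup>2) \<ge> 0" using y by simp
    ultimately show "\<exists>z. (?f has_real_derivative z) (at y) \<and> 0 \<le> z" by metis
  qed
  then show ?thesis by simp
qed

text \<open>Markov's inequality for \<open>(1 + \<delta>) ^ card\<close>. Here \<open>\<mu>\<close>
  need only bound the mean \<open>n / r\<close> from above, as the mean enters the exponent with the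
  positive factor \<open>\<delta>\<close>.\<close>

lemma card_block_Chernoff:
  assumes r: "\<beta> < r" and \<mu>: "real n / real r \<le> \<mu>" and \<delta>: "0 < \<delta>" "\<delta> \<le> 1"
  shows "measure_pmf.prob (random_assignment n r) {f. (1 + \<delta>) * \<mu> \<le> real (card (block n f \<beta>))}
    \<le> exp (- (\<mu> * \<delta>\<^sup>2 / 3))"
proof -
  define c where "c = (1 + \<delta>) powr ((1 + \<delta>) * \<mu>)"
  have "0 \<le> \<mu>" using \<mu> by (rule order_trans[rotated]) simp
  have c: "0 < c" unfolding c_def using \<delta> by simp
  have "{f. (1 + \<delta>) * \<mu> \<le> real (card (block n f \<beta>))} \<subseteq> {f. c \<le> (1 + \<delta>) ^ card (block n f \<beta>)}"
  proof safe
    fix f assume "(1 + \<delta>) * \<mu> \<le> real (card (block n f \<beta>))"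
    then have "c \<le> (1 + \<delta>) powr real (card (block n f \<beta>))"
      unfolding c_def using \<delta> by (intro powr_mono) auto
    then show "c \<le> (1 + \<delta>) ^ card (block n f \<beta>)" using \<delta> by (simp add: powr_realpow)
  qed
  then have "measure_pmf.prob (random_assignment n r) {f. (1 + \<delta>) * \<mu> \<le> real (card (block n f \<beta>))}
      \<le> measure_pmf.prob (random_assignment n r) {f. c \<le> (1 + \<delta>) ^ card (block n f \<beta>)}"
    by (intro measure_pmf.finite_measure_mono) auto
  also have "\<dots> \<le> measure_pmf.expectation (random_assignment n r) (\<lambda>f. (1 + \<delta>) ^ card (block n f \<beta>)) / c"
    using r c \<delta> by (intro random_assignment_Markov) auto
  also have "\<dots> = (1 + \<delta> / real r) ^ n / c"
    by (subst expectation_block[OF r]) (simp add: bernoulli_sum_power_card algebra_simps add_divide_distrib)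
  also have "\<dots> \<le> exp (\<delta> / real r) ^ n / c"
    using \<delta> c by (intro divide_right_mono power_mono exp_ge_add_one_self) auto
  also have "\<dots> = exp (\<delta> * (real n / real r) - \<mu> * ((1 + \<delta>) * ln (1 + \<delta>)))"
    unfolding c_def powr_def using \<delta> by (simp add: exp_of_nat_mult[symmetric] exp_diff mult_ac)
  also have "\<dots> \<le> exp (- (\<mu> * \<delta>\<^sup>2 / 3))"
  proof -
    \<comment> \<open>The denominator \<open>3\<close> comes from
      \<open>2 + \<delta> \<le> 3\<close>.\<close>
    have "\<delta>\<^sup>2 / 3 \<le> \<delta>\<^sup>2 / (2 + \<delta>)" using \<delta> by (intro divide_left_mono) auto
    also have "\<dots> = (1 + \<delta>) * (2 * \<delta> / (2 + \<delta>)) - \<delta>"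
      using \<delta> by (simp add: divide_simps) (simp add: power2_eq_square algebra_simps)
    also have "\<dots> \<le> (1 + \<delta>) * ln (1 + \<delta>) - \<delta>"
      using \<delta> ln_one_plus_ge[of \<delta>] by (intro diff_right_mono mult_left_mono) auto
    finally have "\<mu> * (\<delta>\<^sup>2 / 3) \<le> \<mu> * ((1 + \<delta>) * ln (1 + \<delta>) - \<delta>)"
      using \<open>0 \<le> \<mu>\<close> by (rule mult_left_mono)
    moreover have "\<delta> * (real n / real r) \<le> \<delta> * \<mu>" using \<mu> \<delta> by (intro mult_left_mono) auto
    ultimately show ?thesis by (simp add: algebra_simps)
  qed
  finally show ?thesis .
qed

section \<open>From rank-one POVMs to tight frames\<close>

lemma rank_one_mult_vec: "rank_one a \<psi> *v x = (complex_of_real a * cinner_vec \<psi> x) *s \<psi>"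
  by (simp add: vec_eq_iff rank_one_def matrix_vector_mult_def cinner_vec_def sum_distrib_left
      sum_distrib_right mult_ac)

lemma sum_mat_mult_vec: "(\<Sum>i\<in>S. M i) *v x = (\<Sum>i\<in>S. M i *v x)"
  by (induction S rule: infinite_finite_induct) (simp_all add: matrix_vector_mult_add_rdistrib)

lemma bounded_linear_mat: "bounded_linear (\<lambda>x. (A :: complex ^ 'd ^ 'd) *v x)"
proof -
  have "linear (\<lambda>x. A *v x)"
    by (rule linearI) (simp_all add: matrix_vector_right_distrib scaleR_eq_smult_vec vector_scalar_commute)
  then show ?thesis by (simp add: linear_conv_bounded_linear)
qed

lemma rank_one_psd_nonneg:
  assumes "psd_mat (rank_one a \<psi>)" "norm \<psi> = 1"
  shows "0 \<le> a"
proof -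
  have "cinner_vec \<psi> \<psi> = 1"
    using cinner_frame_pow_real[of \<psi> 0] assms(2) by (simp add: dot_square_norm)
  then have "Re (cinner_vec \<psi> (rank_one a \<psi> *v \<psi>)) = a"
    by (simp add: rank_one_mult_vec cinner_vec_scale_right)
  then show ?thesis using assms(1) unfolding psd_mat_def by metis
qed

text \<open>Scaling by \<open>d\<close> turns the POVM into a tight frame of vectors of norm at most
  1 with constant \<open>D = d\<close>. The exponential moment bound and Jensen's inequality then
  apply, and the result is divided by \<open>d\<close>.\<close>

lemma expectation_op_norm_block:
  fixes M :: "nat \<Rightarrow> complex ^ 'd ^ 'd"
  assumes povm: "is_povm n M"
    and rank1: "\<forall>i<n. M i = rank_one (\<alpha> i) (\<psi> i) \<and> norm (\<psi> i) = 1"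
    and alpha_le: "\<forall>i<n. \<alpha> i \<le> 1 / real CARD('d)"
    and \<beta>: "\<beta> < r"
  shows "measure_pmf.expectation (random_assignment n r) (\<lambda>f. op_norm (\<Sum>i\<in>block n f \<beta>. M i))
    \<le> (exp 1 - 1) / real r + ln (real CARD('d)) / real CARD('d)"
proof -
  define d where "d = real CARD('d)"
  have d: "0 < d" unfolding d_def by simp
  define v where "v i = complex_of_real (sqrt (d * \<alpha> i)) *s \<psi> i" for i
  have \<alpha>0: "0 \<le> \<alpha> i" if "i < n" for i
    using povm rank1 that rank_one_psd_nonneg[of "\<alpha> i" "\<psi> i"] unfolding is_povm_def by metis
  have nv: "norm (v i) \<le> 1" if "i < n" for i
  proof -
    have "norm (v i) = sqrt (d * \<alpha> i)"
      using rank1 that \<alpha>0[OF that] d by (simp add: v_def scaleR_eq_smult_vec[symmetric])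
    moreover have "d * \<alpha> i \<le> 1"
      using alpha_le that d by (simp add: d_def[symmetric] field_simps)
    ultimately show ?thesis by simp
  qed
  have frame: "frame_op v S x = d *\<^sub>R ((\<Sum>i\<in>S. M i) *v x)" if S: "S \<subseteq> {..<n}" for S x
  proof -
    have "cinner_vec (v i) x *s v i = d *\<^sub>R (M i *v x)" if "i \<in> S" for i
    proof -
      have i: "i < n" using S that by auto
      have "complex_of_real (sqrt (d * \<alpha> i)) * complex_of_real (sqrt (d * \<alpha> i)) = complex_of_real (d * \<alpha> i)"
        using \<alpha>0[OF i] d by (simp flip: of_real_mult)
      then show ?thesis using rank1 i
        by (simp add: v_def cinner_vec_scale_left rank_one_mult_vec scaleR_eq_smult_vec
            vector_smult_assoc mult_ac)
    qed
    then show ?thesis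
      by (simp add: frame_op_def sum_mat_mult_vec scaleR_sum_right)
  qed
  have tight: "frame_op v {..<n} u = d *\<^sub>R u" for u
    using frame[of "{..<n}" u] povm by (simp add: is_povm_def)
  have onorm: "onorm (frame_op v S) = d * op_norm (\<Sum>i\<in>S. M i)" if S: "S \<subseteq> {..<n}" for S
  proof -
    have "frame_op v S = (\<lambda>x. d *\<^sub>R ((\<Sum>i\<in>S. M i) *v x))"
      using frame[OF S] by auto
    then show ?thesis
      using onorm_scaleR[OF bounded_linear_mat[of "\<Sum>i\<in>S. M i"], of d] d by (simp add: op_norm_def)
  qed
  let ?E = "measure_pmf.expectation (random_assignment n r)"
  let ?x = "\<lambda>f. d * op_norm (\<Sum>i\<in>block n f \<beta>. M i)"
  \<comment> \<open>The logarithm of the bound on the exponential moment, so that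
    \<open>exp (- K)\<close> times that moment is at most 1.\<close>
  define K where "K = ln d + (exp 1 - 1) * d * (1 / real r)"
  have r: "r \<ge> 1" using \<beta> by simp
  note int = integrable_random_assignment[OF r]
  have "?E (\<lambda>f. exp (?x f)) = ?E (\<lambda>f. exp (onorm (frame_op v (block n f \<beta>))))"
    by (simp add: onorm[OF block_subset])
  also have "\<dots> = bernoulli_sum {..<n} (1 / real r) (\<lambda>S. exp (onorm (frame_op v S)))"
    by (rule expectation_block[OF \<beta>])
  also have "\<dots> \<le> d * exp ((exp 1 - 1) * d * (1 / real r))"
    unfolding d_def by (rule bernoulli_sum_exp_onorm_le) (use r nv tight d_def in auto)
  also have "\<dots> = exp K" using d by (simp add: K_def exp_add)
  finally have E: "?E (\<lambda>f. exp (?x f)) \<le> exp K" .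
  \<comment> \<open>Jensen's inequality in explicit form: \<open>exp\<close> lies above its tangent
    at \<open>K\<close>.\<close>
  have "?E ?x \<le> ?E (\<lambda>f. K - 1 + exp (- K) * exp (?x f))"
  proof (rule integral_mono[OF int int])
    fix f
    show "?x f \<le> K - 1 + exp (- K) * exp (?x f)"
      using exp_ge_add_one_self[of "?x f - K"] by (simp add: exp_diff exp_minus field_simps)
  qed
  also have "\<dots> = K - 1 + exp (- K) * ?E (\<lambda>f. exp (?x f))"
    using int by (subst Bochner_Integration.integral_add) auto
  also have "\<dots> \<le> K - 1 + exp (- K) * exp K"
    using E by (intro add_left_mono mult_left_mono) auto
  also have "\<dots> = K" by (simp add: exp_minus)
  finally have "d * ?E (\<lambda>f. op_norm (\<Sum>i\<in>block n f \<beta>. M i)) \<le> K" by simp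
  then show ?thesis
    unfolding d_def[symmetric] K_def using d by (simp add: field_simps)
qed

text \<open>Triangle inequality for the identity as the sum of the block operators. It keeps the
  denominator of \<open>q_val\<close> positive, so that an upper bound on it can be
  inverted.\<close>

lemma sum_op_norm_blocks_ge_1:
  fixes M :: "nat \<Rightarrow> complex ^ 'd ^ 'd"
  assumes "is_povm n M" and f: "f \<in> {..<n} \<rightarrow>\<^sub>E {..<r}"
  shows "1 \<le> (\<Sum>\<beta><r. op_norm (\<Sum>i\<in>block n f \<beta>. M i))"
proof -
  have "(\<Sum>\<beta><r. \<Sum>i\<in>block n f \<beta>. M i) = (\<Sum>\<beta><r. \<Sum>i\<in>{i \<in> {..<n}. f i = \<beta>}. M i)"
    by (simp add: block_def)
  also have "\<dots> = (\<Sum>i<n. M i)"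
    using f by (intro sum.group) (auto simp: PiE_iff)
  also have "\<dots> = mat 1" using assms(1) by (simp add: is_povm_def)
  finally have "(\<lambda>x. \<Sum>\<beta><r. (\<Sum>i\<in>block n f \<beta>. M i) *v x) = (\<lambda>x. x)"
    by (simp add: sum_mat_mult_vec[symmetric])
  then have "onorm (\<lambda>x. \<Sum>\<beta><r. (\<Sum>i\<in>block n f \<beta>. M i) *v x) = 1"
    by (simp add: onorm_id)
  then show ?thesis
    using onorm_sum[of "{..<r}" "\<lambda>\<beta> x. (\<Sum>i\<in>block n f \<beta>. M i) *v x"] bounded_linear_mat
    by (simp add: op_norm_def)
qed

theorem theorem7:
  fixes M :: "nat \<Rightarrow> complex ^ 'd ^ 'd"
    and \<alpha> :: "nat \<Rightarrow> real" and \<psi> :: "nat \<Rightarrow> complex ^ 'd"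
    and n r :: nat and C \<delta> :: real
  defines "d \<equiv> CARD('d)"
  assumes d2: "d \<ge> 2"
    and povm: "is_povm n M"
    and rank1: "\<forall>i<n. M i = rank_one (\<alpha> i) (\<psi> i) \<and> norm (\<psi> i) = 1"
    and n_le: "n \<le> 2 * d ^ 2"
    and alpha_le: "\<forall>i<n. \<alpha> i \<le> 1 / real d"
    and C_pos: "C > 0" and r_pos: "r \<ge> 1" and r_eq: "real r = C * real d"
    and delta: "0 < \<delta>" "\<delta> \<le> 1"
    and delta3: "\<delta> ^ 3 \<ge> 3 * C / (2 * real d) * (1 + ln (4 * C * real d))"
  shows "measure_pmf.prob (random_assignment n r)
           {f. q_val M r (block n f) \<ge> 1 / (3.44 + 2 * C * ln (real d))
               \<and> (\<forall>\<beta><r. real (card (block n f \<beta>)) \<le> 2 / C * (1 + \<delta>) * real d)}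
         \<ge> 1 / 4"
proof -
  let ?P = "random_assignment n r"
  define Z where "Z f = (\<Sum>\<beta><r. op_norm (\<Sum>i\<in>block n f \<beta>. M i))" for f
  define L where "L = 3.44 + 2 * C * ln (real d)"
  \<comment> \<open>Upper bound for the mean block size:
    \<open>n / r \<le> 2 d^2 / (C d)\<close>.\<close>
  define \<mu> where "\<mu> = 2 * real d / C"
  have L: "0 < L" unfolding L_def using C_pos d2 by (intro add_pos_nonneg mult_nonneg_nonneg) auto
  have d0: "0 < real d" using d2 by simp

  have "measure_pmf.expectation ?P Z
      = (\<Sum>\<beta><r. measure_pmf.expectation ?P (\<lambda>f. op_norm (\<Sum>i\<in>block n f \<beta>. M i)))"
    unfolding Z_def by (intro Bochner_Integration.integral_sum integrable_random_assignment r_pos)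
  also have "\<dots> \<le> (\<Sum>\<beta><r. (exp 1 - 1) / real r + ln (real d) / real d)"
    using expectation_op_norm_block[OF povm rank1] alpha_le unfolding d_def by (intro sum_mono) simp
  also have "\<dots> = exp 1 - 1 + C * ln (real d)"
    using r_pos d0 r_eq C_pos by (simp add: distrib_left)
  \<comment> \<open>This is the origin of \<open>3.44 = 2 * 1.72\<close>:
    \<open>exp 1 < 2.72\<close>.\<close>
  also have "\<dots> \<le> L / 2" unfolding L_def using e_less_272 by simp
  finally have EZ: "measure_pmf.expectation ?P Z \<le> L / 2" .
  have "0 \<le> Z f" for f
    unfolding Z_def op_norm_def by (intro sum_nonneg onorm_pos_le bounded_linear_mat)
  then have "measure_pmf.prob ?P {f. L \<le> Z f} \<le> measure_pmf.expectation ?P Z / L"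
    using r_pos L by (intro random_assignment_Markov)
  also have "\<dots> \<le> 1 / 2" using EZ L by (simp add: field_simps)
  finally have bad1: "measure_pmf.prob ?P {f. L \<le> Z f} \<le> 1 / 2" .

  have "real n \<le> 2 * (real d)\<^sup>2" using n_le by (metis of_nat_le_iff of_nat_mult of_nat_numeral of_nat_power)
  then have \<mu>: "real n / real r \<le> \<mu>"
    unfolding \<mu>_def r_eq using C_pos d0 by (simp add: field_simps power2_eq_square)
  have "exp (- (\<mu> * \<delta>\<^sup>2 / 3)) \<le> 1 / (4 * real r)"
  proof -
    \<comment> \<open>The hypothesis on \<open>\<delta> ^ 3\<close> multiplied by
      \<open>\<mu> / 3 = 2 d / (3 C)\<close>. The resulting tail \<open>1 / (4 r)\<close> per block
      sums to \<open>1 / 4\<close> over the \<open>r\<close> blocks.\<close>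
    have "1 + ln (4 * real r) \<le> \<mu> * \<delta> ^ 3 / 3"
      using delta3 C_pos d0 unfolding \<mu>_def r_eq by (simp add: field_simps)
    also have "\<dots> \<le> \<mu> * \<delta>\<^sup>2 / 3"
      using delta C_pos d0 unfolding \<mu>_def by (intro divide_right_mono mult_left_mono power_decreasing) auto
    finally have "exp (- (\<mu> * \<delta>\<^sup>2 / 3)) \<le> exp (- ln (4 * real r))" by simp
    then show ?thesis using r_pos by (simp add: exp_minus inverse_eq_divide)
  qed
  then have "measure_pmf.prob ?P {f. (1 + \<delta>) * \<mu> \<le> real (card (block n f \<beta>))} \<le> 1 / (4 * real r)"
    if "\<beta> < r" for \<beta>
    using card_block_Chernoff[OF that \<mu> delta] by linarith
  then have "(\<Sum>\<beta><r. measure_pmf.prob ?P {f. (1 + \<delta>) * \<mu> \<le> real (card (block n f \<beta>))})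
      \<le> (\<Sum>\<beta><r. 1 / (4 * real r))"
    by (intro sum_mono) simp
  also have "\<dots> = 1 / 4" using r_pos by simp
  finally have bad2: "measure_pmf.prob ?P (\<Union>\<beta><r. {f. (1 + \<delta>) * \<mu> \<le> real (card (block n f \<beta>))}) \<le> 1 / 4"
    by (intro order_trans[OF measure_pmf.finite_measure_subadditive_finite]) auto

  let ?good = "{f. q_val M r (block n f) \<ge> 1 / (3.44 + 2 * C * ln (real d))
      \<and> (\<forall>\<beta><r. real (card (block n f \<beta>)) \<le> 2 / C * (1 + \<delta>) * real d)}"
  let ?bad = "{f. L \<le> Z f} \<union> (\<Union>\<beta><r. {f. (1 + \<delta>) * \<mu> \<le> real (card (block n f \<beta>))})"
  \<comment> \<open>The support is needed for \<open>1 \<le> Z f\<close>, which requires every index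
    to lie in some block \<open>\<beta> < r\<close>.\<close>
  have "(- ?bad) \<inter> set_pmf ?P \<subseteq> ?good"
  proof
    fix f assume "f \<in> (- ?bad) \<inter> set_pmf ?P"
    then have f: "f \<in> set_pmf ?P" "Z f < L"
      "\<forall>\<beta><r. real (card (block n f \<beta>)) < (1 + \<delta>) * \<mu>" by (auto simp: not_le)
    have "1 \<le> Z f"
      unfolding Z_def using f(1) r_pos povm by (intro sum_op_norm_blocks_ge_1) (simp_all add: set_pmf_random_assignment)
    then have "inverse L \<le> inverse (Z f)" using f(2) by (intro le_imp_inverse_le) auto
    then have "1 / (3.44 + 2 * C * ln (real d)) \<le> q_val M r (block n f)"
      unfolding q_val_def Z_def L_def by (simp add: inverse_eq_divide)
    moreover have "real (card (block n f \<beta>)) \<le> 2 / C * (1 + \<delta>) * real d" if "\<beta> < r" for \<beta>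
      using f(3) that unfolding \<mu>_def by (auto simp: mult_ac intro: less_imp_le)
    ultimately show "f \<in> ?good" by blast
  qed
  then have "measure_pmf.prob ?P ((- ?bad) \<inter> set_pmf ?P) \<le> measure_pmf.prob ?P ?good"
    by (intro measure_pmf.finite_measure_mono) auto
  moreover have "measure_pmf.prob ?P (- ?bad) = 1 - measure_pmf.prob ?P ?bad"
    using measure_pmf.prob_compl[of ?bad ?P] by (simp add: Compl_eq_Diff_UNIV)
  moreover have "measure_pmf.prob ?P ?bad \<le> 1 / 2 + 1 / 4"
    using bad1 bad2 by (intro order_trans[OF measure_Un_le] add_mono) auto
  ultimately show ?thesis by (simp add: measure_Int_set_pmf)
qed

end
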